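(* Let $S$ be a locally compact topological space, let $X=C_0(S)$ with open unit ball $B_X$, and let $x,y\in B_X$ with $x\ne y$. If $z\in\mathbb{C}$, $z\neq0$, satisfies $$|z|\le\frac{1+\max\{\|x\|,\|y\|\}}{2\max\{\|x\|,\|y\|\}},$$ then $$\frac{\rho_X(zx,zy)}{|z|\,\rho_X(x,y)}\le 2 .$$
   Context: $C_0(S)$ is the Banach space, with the sup-norm, of continuous functions $f:S\to\mathbb{C}$ such that for any $\varepsilon>0$ there is a closed compact subset $K\subset S$ with $|f(t)|<\varepsilon$ for all $t\in S\setminus K$. For a complex Banach space $X$ with open unit ball $B_X$, the pseudohyperbolic distance of $x,y\in B_X$ is $$\rho_X(x,y)=\sup\{\rho(f(x),f(y)) : f\in H^\infty(B_X),\ \|f\|_\infty\le 1\},$$ where $H^\infty(B_X)$ is the space of bounded holomorphic (Fréchet differentiable) functions $B_X\to\mathbb{C}$ with the sup-norm and $\rho(a,b)=\left|\frac{a-b}{1-\bar a b}\right|$ for $a,b$ in the open unit disk. For $X=C_0(S)$ it is well known that $\rho_X(x,y)=\sup_{t\in S}\rho(x(t),y(t))$, and this formula may be taken as the definition. *)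

theory Defs
  imports "HOL-Analysis.Analysis"
begin

text \<open>Complex normed and complex Banach spaces. The real structure is the one obtained by
  restricting the scalars, so that the derivatives of the library are available.\<close>

class complex_normed_vector = real_normed_vector +
  fixes scaleC :: "complex \<Rightarrow> 'a \<Rightarrow> 'a"  (infixr "*\<^sub>C" 75)
  assumes scaleR_scaleC: "scaleR r x = scaleC (complex_of_real r) x"
    and scaleC_add_right: "scaleC a (x + y) = scaleC a x + scaleC a y"
    and scaleC_add_left: "scaleC (a + b) x = scaleC a x + scaleC b x"
    and scaleC_scaleC: "scaleC a (scaleC b x) = scaleC (a * b) x"
    and scaleC_one: "scaleC 1 x = x"
    and norm_scaleC: "norm (scaleC a x) = cmod a * norm x"

class complex_banach = complex_normed_vector + complete_space

text \<open>A Frechet derivative over the complex numbers is a bounded real-linear one that commutes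
  with complex scalars.\<close>

definition frechet_holomorphic_on ::
    "('b::complex_normed_vector \<Rightarrow> complex) \<Rightarrow> 'b set \<Rightarrow> bool"
    (infixl "frechet'_holomorphic'_on" 50)
  where "f frechet_holomorphic_on U \<longleftrightarrow>
    (\<forall>x\<in>U. \<exists>D. (f has_derivative D) (at x) \<and> (\<forall>c h. D (c *\<^sub>C h) = c * D h))"

definition disk_pseudohyperbolic :: "complex \<Rightarrow> complex \<Rightarrow> real"
  where "disk_pseudohyperbolic a b = cmod ((a - b) / (1 - cnj a * b))"

text \<open>A holomorphic function of supremum norm at most 1 on the unit ball either maps into the
  open unit disk or is a constant of modulus 1 (maximum principle). In the latter case
  division by zero makes the term below equal to 0, which does not affect the supremum.\<close>

definition pseudohyperbolic :: "'b::complex_banach \<Rightarrow> 'b \<Rightarrow> real"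
  where "pseudohyperbolic x y =
    (SUP f \<in> {f. f frechet_holomorphic_on ball 0 1 \<and> (\<forall>w\<in>ball 0 1. cmod (f w) \<le> 1)}.
       disk_pseudohyperbolic (f x) (f y))"


text \<open>The Banach space of continuous functions vanishing at infinity on the space \<open>'s\<close>, which
  need not be Hausdorff.\<close>

typedef (overloaded) ('s::topological_space) c0 =
  "{f :: 's \<Rightarrow> complex. continuous_on UNIV f \<and>
     (\<forall>\<epsilon>>0. \<exists>K. closed K \<and> compact K \<and> (\<forall>t\<in>- K. cmod (f t) < \<epsilon>))}"
  morphisms apply_c0 Abs_c0
  by (rule exI[of _ "\<lambda>_. 0"]) (auto intro!: exI[of _ "{}"])

setup_lifting type_definition_c0

lemma c0_eqI: "(\<And>t. apply_c0 f t = apply_c0 g t) \<Longrightarrow> f = g"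
  by transfer auto

lemma continuous_on_apply_c0: "continuous_on UNIV (apply_c0 f)"
  by transfer auto

lemma apply_c0_vanishes:
  "\<epsilon> > 0 \<Longrightarrow> \<exists>K. closed K \<and> compact K \<and> (\<forall>t\<in>- K. cmod (apply_c0 f t) < \<epsilon>)"
  using apply_c0[of f] by simp

lemma bounded_range_apply_c0: "bounded (range (apply_c0 f))"
proof -
  obtain K where K: "compact K" "\<forall>t\<in>- K. cmod (apply_c0 f t) < 1"
    using apply_c0_vanishes[OF zero_less_one, of f] by blast
  have "compact (apply_c0 f ` K)"
    using K(1) by (intro compact_continuous_image continuous_on_subset[OF continuous_on_apply_c0]) auto
  then obtain B where B: "\<forall>z\<in>apply_c0 f ` K. cmod z \<le> B"
    using compact_imp_bounded bounded_iff by blast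
  have "cmod (apply_c0 f t) \<le> max B 1" for t
  proof (cases "t \<in> K")
    case True
    then show ?thesis using B by (simp add: le_max_iff_disj)
  next
    case False
    then show ?thesis using bspec[OF K(2), of t] by (simp add: le_max_iff_disj)
  qed
  then show ?thesis
    unfolding bounded_iff by blast
qed

instantiation c0 :: (topological_space) real_normed_vector
begin

lift_definition zero_c0 :: "'a c0" is "\<lambda>_. 0"
  by (auto intro!: exI[of _ "{}"])

lift_definition plus_c0 :: "'a c0 \<Rightarrow> 'a c0 \<Rightarrow> 'a c0" is "\<lambda>f g t. f t + g t"
proof (intro conjI allI impI, goal_cases)
  case (1 f g)
  then show ?case by (auto intro: continuous_intros)
next
  case (2 f g \<epsilon>)
  then have "\<epsilon> / 2 > 0" by simp
  then obtain K L where
    K: "closed K" "compact K" "\<forall>t\<in>- K. cmod (f t) < \<epsilon> / 2" and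
    L: "closed L" "compact L" "\<forall>t\<in>- L. cmod (g t) < \<epsilon> / 2"
    using 2(1,2) by blast
  have "cmod (f t + g t) < \<epsilon>" if "t \<in> - (K \<union> L)" for t
    using bspec[OF K(3), of t] bspec[OF L(3), of t] that norm_triangle_ineq[of "f t" "g t"]
    by simp
  then show ?case
    using K L by (intro exI[of _ "K \<union> L"]) auto
qed

lift_definition uminus_c0 :: "'a c0 \<Rightarrow> 'a c0" is "\<lambda>f t. - f t"
  by (auto intro: continuous_intros)

definition minus_c0 :: "'a c0 \<Rightarrow> 'a c0 \<Rightarrow> 'a c0"
  where "f - g = f + - g" for f g :: "'a c0"

lemma scaled_c0_aux:
  assumes "continuous_on UNIV f \<and>
     (\<forall>\<epsilon>>0. \<exists>K. closed K \<and> compact K \<and> (\<forall>t\<in>- K. cmod (f t) < \<epsilon>))"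
  shows "continuous_on UNIV (\<lambda>t. c * f t) \<and>
     (\<forall>\<epsilon>>0. \<exists>K. closed K \<and> compact K \<and> (\<forall>t\<in>- K. cmod (c * f t) < \<epsilon>))"
proof (intro conjI allI impI)
  show "continuous_on UNIV (\<lambda>t. c * f t)"
    using assms by (auto intro: continuous_intros)
  fix \<epsilon> :: real assume \<epsilon>: "\<epsilon> > 0"
  have pos: "\<epsilon> / (cmod c + 1) > 0"
    using \<epsilon> by (simp add: add_nonneg_pos)
  obtain K where K: "closed K" "compact K" "\<forall>t\<in>- K. cmod (f t) < \<epsilon> / (cmod c + 1)"
    using assms pos by blast
  have "cmod (c * f t) < \<epsilon>" if "t \<in> - K" for t
  proof -
    have "cmod (c * f t) \<le> (cmod c + 1) * cmod (f t)"
      by (simp add: norm_mult mult_right_mono)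
    also have "\<dots> < \<epsilon>"
      using K(3) that by (simp add: pos_less_divide_eq add_nonneg_pos mult.commute)
    finally show ?thesis .
  qed
  then show "\<exists>K. closed K \<and> compact K \<and> (\<forall>t\<in>- K. cmod (c * f t) < \<epsilon>)"
    using K by blast
qed

lift_definition scaleR_c0 :: "real \<Rightarrow> 'a c0 \<Rightarrow> 'a c0" is "\<lambda>r f t. complex_of_real r * f t"
  by (rule scaled_c0_aux)

definition norm_c0 :: "'a c0 \<Rightarrow> real"
  where "norm_c0 f = (SUP t. cmod (apply_c0 f t))"

definition dist_c0 :: "'a c0 \<Rightarrow> 'a c0 \<Rightarrow> real"
  where "dist_c0 f g = norm (f - g)"

definition sgn_c0 :: "'a c0 \<Rightarrow> 'a c0"
  where "sgn_c0 f = scaleR (inverse (norm f)) f"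

definition uniformity_c0 :: "('a c0 \<times> 'a c0) filter"
  where "uniformity_c0 = (INF e\<in>{0 <..}. principal {(f, g). dist f g < e})"

definition open_c0 :: "'a c0 set \<Rightarrow> bool"
  where "open_c0 U \<longleftrightarrow> (\<forall>f\<in>U. \<forall>\<^sub>F (f', g) in uniformity. f' = f \<longrightarrow> g \<in> U)"

lemma norm_apply_c0_le: "cmod (apply_c0 f t) \<le> norm f"
proof -
  obtain B where "\<forall>u\<in>range (apply_c0 f). cmod u \<le> B"
    using bounded_range_apply_c0[of f] unfolding bounded_iff ..
  then have "bdd_above (range (\<lambda>t. cmod (apply_c0 f t)))"
    by (intro bdd_aboveI2[of _ _ B]) simp
  then show ?thesis
    using cSUP_upper[of t UNIV "\<lambda>t. cmod (apply_c0 f t)"] by (simp add: norm_c0_def)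
qed

lemma norm_c0_leI:
  assumes "\<And>t. cmod (apply_c0 f t) \<le> b"
  shows "norm f \<le> b"
  using cSUP_least[of UNIV "\<lambda>t. cmod (apply_c0 f t)" b] assms by (simp add: norm_c0_def)

instance
proof
  fix a b :: real and f g h :: "'a c0"
  show "f + g + h = f + (g + h)" "f + g = g + f" "0 + f = f" "- f + f = 0"
    "a *\<^sub>R (f + g) = a *\<^sub>R f + a *\<^sub>R g" "(a + b) *\<^sub>R f = a *\<^sub>R f + b *\<^sub>R f"
    "a *\<^sub>R b *\<^sub>R f = (a * b) *\<^sub>R f" "1 *\<^sub>R f = f"
    by (rule c0_eqI;
        simp add: plus_c0.rep_eq zero_c0.rep_eq uminus_c0.rep_eq scaleR_c0.rep_eq algebra_simps)+
  show "f - g = f + - g"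
    by (rule minus_c0_def)
  show "dist f g = norm (f - g)"
    by (rule dist_c0_def)
  show "sgn f = inverse (norm f) *\<^sub>R f"
    by (rule sgn_c0_def)
  show "(uniformity :: ('a c0 \<times> 'a c0) filter) = (INF e\<in>{0 <..}. principal {(f, g). dist f g < e})"
    by (rule uniformity_c0_def)
  show "open U = (\<forall>f\<in>U. \<forall>\<^sub>F (f', g) in uniformity. f' = f \<longrightarrow> g \<in> U)" for U :: "'a c0 set"
    by (rule open_c0_def)
  show "norm f = 0 \<longleftrightarrow> f = 0"
  proof
    assume "norm f = 0"
    then have "apply_c0 f t = 0" for t
      using norm_apply_c0_le[of f t] by simp
    then show "f = 0"
      by (intro c0_eqI) (simp add: zero_c0.rep_eq)
  next
    assume "f = 0"
    then show "norm f = 0"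
      by (simp add: norm_c0_def zero_c0.rep_eq)
  qed
  show "norm (f + g) \<le> norm f + norm g"
  proof (rule norm_c0_leI)
    fix t
    have "cmod (apply_c0 (f + g) t) \<le> cmod (apply_c0 f t) + cmod (apply_c0 g t)"
      by (simp add: plus_c0.rep_eq norm_triangle_ineq)
    also have "\<dots> \<le> norm f + norm g"
      by (intro add_mono norm_apply_c0_le)
    finally show "cmod (apply_c0 (f + g) t) \<le> norm f + norm g" .
  qed
  have scale_le: "norm (r *\<^sub>R k) \<le> \<bar>r\<bar> * norm k" for r and k :: "'a c0"
    by (rule norm_c0_leI) (simp add: scaleR_c0.rep_eq norm_mult mult_left_mono norm_apply_c0_le)
  show "norm (a *\<^sub>R f) = \<bar>a\<bar> * norm f"
  proof (cases "a = 0")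
    case True
    then show ?thesis
      by (simp add: norm_c0_def scaleR_c0.rep_eq)
  next
    case False
    have eq: "inverse a *\<^sub>R a *\<^sub>R f = f"
      using False by (intro c0_eqI) (simp add: scaleR_c0.rep_eq)
    have "norm f \<le> \<bar>inverse a\<bar> * norm (a *\<^sub>R f)"
      using scale_le[of "inverse a" "a *\<^sub>R f"] unfolding eq .
    then have "\<bar>a\<bar> * norm f \<le> \<bar>a\<bar> * (\<bar>inverse a\<bar> * norm (a *\<^sub>R f))"
      by (rule mult_left_mono) simp
    also have "\<dots> = norm (a *\<^sub>R f)"
      using False by (simp add: abs_mult flip: mult.assoc)
    finally show ?thesis
      using scale_le[of a f] by simp
  qed
qed

end

lemma apply_c0_diff: "apply_c0 (f - g) t = apply_c0 f t - apply_c0 g t"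
  unfolding minus_c0_def plus_c0.rep_eq uminus_c0.rep_eq by simp

lemma dist_apply_c0_le: "dist (apply_c0 f t) (apply_c0 g t) \<le> dist f g"
  using norm_apply_c0_le[of "f - g" t] by (simp add: dist_norm apply_c0_diff)

instantiation c0 :: (topological_space) complex_banach
begin

lift_definition scaleC_c0 :: "complex \<Rightarrow> 'a c0 \<Rightarrow> 'a c0" is "\<lambda>c f t. c * f t"
  by (rule scaled_c0_aux)

instance
proof
  fix a b :: complex and r :: real and f g :: "'a c0"
  show "r *\<^sub>R f = complex_of_real r *\<^sub>C f" "a *\<^sub>C (f + g) = a *\<^sub>C f + a *\<^sub>C g"
    "(a + b) *\<^sub>C f = a *\<^sub>C f + b *\<^sub>C f" "a *\<^sub>C b *\<^sub>C f = (a * b) *\<^sub>C f" "1 *\<^sub>C f = f"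
    by (rule c0_eqI;
        simp add: plus_c0.rep_eq scaleR_c0.rep_eq scaleC_c0.rep_eq algebra_simps)+
  have scale_le: "norm (c *\<^sub>C k) \<le> cmod c * norm k" for c and k :: "'a c0"
    by (rule norm_c0_leI) (simp add: scaleC_c0.rep_eq norm_mult mult_left_mono norm_apply_c0_le)
  show "norm (a *\<^sub>C f) = cmod a * norm f"
  proof (cases "a = 0")
    case True
    then show ?thesis
      by (simp add: norm_c0_def scaleC_c0.rep_eq)
  next
    case False
    have eq: "inverse a *\<^sub>C a *\<^sub>C f = f"
      using False by (intro c0_eqI) (simp add: scaleC_c0.rep_eq)
    have "norm f \<le> cmod (inverse a) * norm (a *\<^sub>C f)"
      using scale_le[of "inverse a" "a *\<^sub>C f"] unfolding eq .
    then have "cmod a * norm f \<le> cmod a * (cmod (inverse a) * norm (a *\<^sub>C f))"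
      by (rule mult_left_mono) simp
    also have "\<dots> = norm (a *\<^sub>C f)"
      using False by (simp add: norm_inverse flip: mult.assoc)
    finally show ?thesis
      using scale_le[of a f] by simp
  qed
next
  fix X :: "nat \<Rightarrow> 'a c0"
  assume "Cauchy X"
  then have unif: "uniformly_Cauchy_on UNIV (\<lambda>n. apply_c0 (X n))"
    unfolding Cauchy_def uniformly_Cauchy_on_def
    by (meson dist_apply_c0_le order.strict_trans1)
  then obtain l where l: "uniform_limit UNIV (\<lambda>n. apply_c0 (X n)) l sequentially"
    using Cauchy_uniformly_convergent uniformly_convergent_on_def by blast
  have cont: "continuous_on UNIV l"
    by (rule uniform_limit_theorem[OF _ l]) (auto simp: continuous_on_apply_c0)
  have "\<exists>K. closed K \<and> compact K \<and> (\<forall>t\<in>- K. cmod (l t) < \<epsilon>)" if pos: "\<epsilon> > 0" for \<epsilon>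
  proof -
    obtain n where n: "\<forall>t. dist (apply_c0 (X n) t) (l t) < \<epsilon> / 2"
      using l half_gt_zero[OF pos] unfolding uniform_limit_sequentially_iff by blast
    obtain K where K: "closed K" "compact K" "\<forall>t\<in>- K. cmod (apply_c0 (X n) t) < \<epsilon> / 2"
      using apply_c0_vanishes[OF half_gt_zero[OF pos], of "X n"] by blast
    have "cmod (l t) < \<epsilon>" if "t \<in> - K" for t
    proof -
      have "cmod (l t) \<le> cmod (apply_c0 (X n) t) + dist (apply_c0 (X n) t) (l t)"
        by (metis dist_norm norm_triangle_sub dist_commute)
      then show ?thesis
        using spec[OF n, of t] bspec[OF K(3) that] by simp
    qed
    then show ?thesis
      using K by blast
  qed
  then have L: "apply_c0 (Abs_c0 l) = l"
    using cont by (simp add: Abs_c0_inverse)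
  have "X \<longlonglongrightarrow> Abs_c0 l"
  proof (rule metric_LIMSEQ_I)
    fix e :: real assume "e > 0"
    then obtain N where N: "\<forall>n\<ge>N. \<forall>t. dist (apply_c0 (X n) t) (l t) < e / 2"
      using l half_gt_zero[OF \<open>e > 0\<close>] unfolding uniform_limit_sequentially_iff by blast
    have "dist (X n) (Abs_c0 l) < e" if "n \<ge> N" for n
    proof -
      have "dist (X n) (Abs_c0 l) \<le> e / 2"
        unfolding dist_c0_def
        using N that by (intro norm_c0_leI) (simp add: apply_c0_diff L dist_norm less_imp_le)
      then show ?thesis
        using \<open>e > 0\<close> by simp
    qed
    then show "\<exists>N. \<forall>n\<ge>N. dist (X n) (Abs_c0 l) < e"
      by blast
  qed
  then show "convergent X"
    by (rule convergentI)
qed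

end

end

theory Submission
  imports Defs "HOL-Complex_Analysis.Conformal_Mappings"
begin

text \<open>The theorem reduces to the disk, because the pseudohyperbolic distance of \<open>C\<^sub>0(S)\<close> is
  the supremum of the distances \<open>\<rho>(x(t), y(t))\<close>. Only two inequalities are used: a bound from
  below for the pair \<open>x, y\<close> and a bound from above for the pair \<open>zx, zy\<close>.

  The bound from below (\<open>disk_pseudohyperbolic_apply_c0_le\<close>) holds since evaluation at a point is
  one of the competing holomorphic functions.

  The bound from above (\<open>pseudohyperbolic_c0_le\<close>) is the dual construction. Suppose that \<open>0 < r < 1\<close>
  and \<open>\<rho>(u(t), v(t)) \<le> r\<close> for all \<open>t\<close>. Then each pair \<open>u(t), v(t)\<close> is the image of the pair
  \<open>0, r\<close> under a holomorphic self-map of the disk, namely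
  \<open>\<zeta> \<mapsto> (u(t) + \<zeta> w(t)) / (1 + \<zeta> cnj u(t) w(t))\<close> with
  \<open>w(t) = (v(t) - u(t)) / (r (1 - cnj u(t) v(t)))\<close>, where the hypothesis says \<open>|w(t)| \<le> 1\<close>.
  For varying \<open>t\<close> these maps form a single holomorphic disk in the unit ball of \<open>C\<^sub>0(S)\<close>
  through \<open>u\<close> and \<open>v\<close>. Composing it with a competing function \<open>f\<close> gives a holomorphic function
  of one variable, and the Schwarz-Pick lemma yields \<open>\<rho>(f(u), f(v)) \<le> r\<close>.

  What remains is \<open>\<rho>(za, zb) \<le> 2|z| \<rho>(a, b)\<close> for \<open>|a|, |b| \<le> M < 1\<close> and
  \<open>|z| \<le> (1 + M) / (2M)\<close> (\<open>disk_pseudohyperbolic_scale_le\<close>). With \<open>c = cnj a b\<close> and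
  \<open>s = |z|\<^sup>2\<close> it says \<open>|1 - c| \<le> 2 |1 - sc|\<close>, which follows from the triangle inequality.\<close>

section \<open>The pseudohyperbolic distance of the disk\<close>

lemma cmod_one_minus_cnj_mult:
  "(cmod (1 - cnj a * b))\<^sup>2 - (cmod (a - b))\<^sup>2 = (1 - (cmod a)\<^sup>2) * (1 - (cmod b)\<^sup>2)"
  unfolding cmod_power2 by (simp add: power2_eq_square algebra_simps)

lemma disk_pseudohyperbolic_nonneg: "disk_pseudohyperbolic a b \<ge> 0"
  by (simp add: disk_pseudohyperbolic_def)

lemma disk_pseudohyperbolic_le_1:
  assumes "cmod a \<le> 1" and "cmod b \<le> 1"
  shows "disk_pseudohyperbolic a b \<le> 1"
proof -
  have "(1 - (cmod a)\<^sup>2) * (1 - (cmod b)\<^sup>2) \<ge> 0"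
    using assms by (simp add: power_le_one)
  then have "(cmod (a - b))\<^sup>2 \<le> (cmod (1 - cnj a * b))\<^sup>2"
    using cmod_one_minus_cnj_mult[of a b] by linarith
  then have "cmod (a - b) \<le> cmod (1 - cnj a * b)"
    by (rule power2_le_imp_le) simp
  then show ?thesis
    by (simp add: disk_pseudohyperbolic_def norm_divide divide_le_eq_1)
qed

lemma cmod_one_plus_ge:
  assumes "cmod q \<le> a"
  shows "1 - a \<le> cmod (1 + q)"
  using norm_triangle_ineq2[of 1 "- q"] assms by simp

lemma disk_moebius_less_1:
  assumes "cmod a < 1" and "cmod b < 1"
  shows "cmod ((a - b) / (1 - cnj a * b)) < 1"
proof -
  have "(1 - (cmod a)\<^sup>2) * (1 - (cmod b)\<^sup>2) > 0"
    using assms by (simp add: power_less_one_iff)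
  then have "(cmod (a - b))\<^sup>2 < (cmod (1 - cnj a * b))\<^sup>2"
    using cmod_one_minus_cnj_mult[of a b] by linarith
  then have "cmod (a - b) < cmod (1 - cnj a * b)"
    by (rule power2_less_imp_less) simp
  then show ?thesis
    by (simp add: norm_divide divide_less_eq_1)
qed

text \<open>The function may take values on the unit circle, as the competing functions in the definition
  of the distance do; by the maximum principle it is then constant. Otherwise the Schwarz
  lemma applies after an automorphism of the disk that moves the value at 0 to 0.\<close>

lemma Schwarz_Pick_at_0:
  assumes hol: "h holomorphic_on ball 0 1"
    and le: "\<And>\<zeta>. cmod \<zeta> < 1 \<Longrightarrow> cmod (h \<zeta>) \<le> 1"
    and r: "cmod r < 1"
  shows "disk_pseudohyperbolic (h 0) (h r) \<le> cmod r"
proof (cases "\<exists>\<xi>. cmod \<xi> < 1 \<and> cmod (h \<xi>) = 1")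
  case True
  then obtain \<xi> where \<xi>: "cmod \<xi> < 1" "cmod (h \<xi>) = 1" by blast
  have "h constant_on ball 0 1"
    by (rule maximum_modulus_principle[OF hol _ _ _ order_refl, of \<xi>]) (use \<xi> le in auto)
  then have "h 0 = h r"
    using r unfolding constant_on_def by auto
  then show ?thesis
    by (simp add: disk_pseudohyperbolic_def)
next
  case False
  then have less: "cmod (h \<zeta>) < 1" if "cmod \<zeta> < 1" for \<zeta>
    using le[OF that] that by force
  define \<phi> where "\<phi> \<zeta> = (h 0 - h \<zeta>) / (1 - cnj (h 0) * h \<zeta>)" for \<zeta>
  have nz: "1 - cnj (h 0) * h \<zeta> \<noteq> 0" if "cmod \<zeta> < 1" for \<zeta>
  proof -
    have "cmod (cnj (h 0) * h \<zeta>) < 1"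
      using mult_strict_mono[of "cmod (h 0)" 1 "cmod (h \<zeta>)" 1] less[OF that] less[of 0]
      by (simp add: norm_mult)
    then show ?thesis by auto
  qed
  have "cmod (\<phi> r) \<le> cmod r"
  proof (rule Schwarz_Lemma(1))
    show "\<phi> holomorphic_on ball 0 1"
      unfolding \<phi>_def using nz by (intro holomorphic_intros hol) auto
    show "\<phi> 0 = 0" by (simp add: \<phi>_def)
    show "cmod (\<phi> \<zeta>) < 1" if "cmod \<zeta> < 1" for \<zeta>
      unfolding \<phi>_def using disk_moebius_less_1 less that by simp
  qed (rule r)
  then show ?thesis
    by (simp add: disk_pseudohyperbolic_def \<phi>_def)
qed

text \<open>After cancelling \<open>|z| |a - b|\<close> the claim compares the denominators: \<open>|1 - c| \<le> 2 |1 - sc|\<close>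
  for \<open>c = cnj a b\<close> and \<open>s = |z|\<^sup>2\<close>. Since \<open>1 - c = (1 - sc) + (s - 1) c\<close>, it suffices that
  \<open>|s - 1| |c| \<le> 1 - s|c|\<close>. For \<open>s \<le> 1\<close> this is \<open>|c| \<le> 1\<close>. For \<open>s > 1\<close> it is
  \<open>(2s - 1)|c| \<le> 1\<close>, and the bounds \<open>|c| \<le> M\<^sup>2\<close> and \<open>s M\<^sup>2 \<le> (1 + M)\<^sup>2/4\<close> reduce this to
  \<open>(1 - M)\<^sup>2 \<ge> 0\<close>.\<close>

lemma disk_pseudohyperbolic_scale_le:
  assumes a: "cmod a \<le> M" and b: "cmod b \<le> M" and M: "0 < M" "M < 1"
    and z: "cmod z \<le> (1 + M) / (2 * M)"
  shows "disk_pseudohyperbolic (z * a) (z * b) \<le> 2 * cmod z * disk_pseudohyperbolic a b"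
proof -
  define s where "s = (cmod z)\<^sup>2"
  define c where "c = cnj a * b"
  have s0: "s \<ge> 0" by (simp add: s_def)
  have c: "cmod c \<le> M\<^sup>2"
    using mult_mono[OF a b] M by (simp add: c_def norm_mult power2_eq_square)
  have "M\<^sup>2 < 1" using M by (simp add: power_less_one_iff)
  have "cmod z * M \<le> (1 + M) / 2"
    using z M by (simp add: field_simps)
  then have "(cmod z * M)\<^sup>2 \<le> ((1 + M) / 2)\<^sup>2"
    using M by (intro power_mono) auto
  then have sM: "s * M\<^sup>2 \<le> (1 + M)\<^sup>2 / 4"
    by (simp add: s_def power_mult_distrib power_divide)
  have "(1 + M)\<^sup>2 / 4 < 1"
    using M power_strict_mono[of "1 + M" 2 2] by simp
  moreover have sc: "s * cmod c \<le> s * M\<^sup>2"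
    using c s0 by (rule mult_left_mono)
  ultimately have lt: "s * cmod c < 1"
    using sM by linarith
  have key: "\<bar>s - 1\<bar> * cmod c \<le> 1 - s * cmod c"
  proof (cases "s \<le> 1")
    case True
    then show ?thesis
      using c \<open>M\<^sup>2 < 1\<close> by (simp add: algebra_simps)
  next
    case False
    have "(2 * s - 1) * cmod c \<le> (2 * s - 1) * M\<^sup>2"
      using c False by (intro mult_left_mono) auto
    also have "\<dots> \<le> (1 + M)\<^sup>2 / 2 - M\<^sup>2"
      using sM by (simp add: algebra_simps)
    also have "\<dots> \<le> 1"
      using zero_le_power2[of "1 - M"] by (simp add: power2_eq_square algebra_simps)
    finally show ?thesis
      using False by (simp add: algebra_simps)
  qed
  have lower: "1 - s * cmod c \<le> cmod (1 - s * c)"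
    using norm_triangle_ineq2[of 1 "s * c"] s0 by (simp add: norm_mult)
  have "cmod (1 - c) = cmod ((1 - s * c) + (s - 1) * c)"
    by (simp add: algebra_simps)
  also have "\<dots> \<le> cmod (1 - s * c) + \<bar>s - 1\<bar> * cmod c"
    by (metis norm_triangle_ineq norm_mult norm_of_real of_real_1 of_real_diff)
  also have "\<dots> \<le> 2 * cmod (1 - s * c)"
    using key lower by linarith
  finally have main: "cmod (1 - c) \<le> 2 * cmod (1 - s * c)" .
  have c1: "cmod (1 - c) > 0"
    using c \<open>M\<^sup>2 < 1\<close> by auto
  have s1: "cmod (1 - s * c) > 0"
    using lt lower by linarith
  have "cnj (z * a) * (z * b) = s * c"
    using complex_norm_square[of z] by (simp add: s_def c_def mult_ac)
  then have "disk_pseudohyperbolic (z * a) (z * b) = cmod z * cmod (a - b) / cmod (1 - s * c)"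
    by (simp add: disk_pseudohyperbolic_def norm_divide flip: norm_mult right_diff_distrib)
  also have "\<dots> \<le> 2 * cmod z * (cmod (a - b) / cmod (1 - c))"
    using mult_left_mono[OF main, of "cmod z * cmod (a - b)"] c1 s1
    by (simp add: divide_simps mult_ac)
  finally show ?thesis
    by (simp add: disk_pseudohyperbolic_def norm_divide c_def)
qed

section \<open>The pseudohyperbolic distance and holomorphic disks in Banach spaces\<close>

lemma bounded_linear_scaleC_left: "bounded_linear (\<lambda>c. c *\<^sub>C (v :: 'b::complex_normed_vector))"
proof (rule bounded_linear_intro[where K = "norm v"])
  show "(r *\<^sub>R c) *\<^sub>C v = r *\<^sub>R (c *\<^sub>C v)" for r c
    by (simp add: scaleR_scaleC scaleC_scaleC scaleR_conv_of_real)
qed (simp_all add: scaleC_add_left norm_scaleC)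

lemma frechet_holomorphic_comp_field_differentiable:
  fixes g :: "complex \<Rightarrow> 'b::complex_normed_vector"
  assumes f: "f frechet_holomorphic_on U" and U: "g \<zeta> \<in> U"
    and g: "(g has_derivative (\<lambda>c. c *\<^sub>C v)) (at \<zeta>)"
  shows "(f \<circ> g) field_differentiable (at \<zeta>)"
proof -
  obtain D where D: "(f has_derivative D) (at (g \<zeta>))" "\<And>c h. D (c *\<^sub>C h) = c * D h"
    using f U unfolding frechet_holomorphic_on_def by blast
  have "((f \<circ> g) has_derivative (D \<circ> (\<lambda>c. c *\<^sub>C v))) (at \<zeta>)"
    by (rule diff_chain_at[OF g D(1)])
  moreover have "D \<circ> (\<lambda>c. c *\<^sub>C v) = (*) (D v)"
    by (simp add: D(2) fun_eq_iff mult.commute)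
  ultimately show ?thesis
    unfolding field_differentiable_def has_field_derivative_def by auto
qed

text \<open>The supremum that defines the distance is over a set of reals bounded by 1, so each
  competing function gives a bound from below.\<close>

lemma disk_pseudohyperbolic_le_pseudohyperbolic:
  fixes x y :: "'b::complex_banach"
  assumes "x \<in> ball 0 1" and "y \<in> ball 0 1"
    and "f frechet_holomorphic_on ball 0 1" and "\<And>w. w \<in> ball 0 1 \<Longrightarrow> cmod (f w) \<le> 1"
  shows "disk_pseudohyperbolic (f x) (f y) \<le> pseudohyperbolic x y"
  unfolding pseudohyperbolic_def
proof (rule cSUP_upper)
  show "bdd_above ((\<lambda>f. disk_pseudohyperbolic (f x) (f y)) `
      {f. f frechet_holomorphic_on ball 0 1 \<and> (\<forall>w\<in>ball 0 1. cmod (f w) \<le> 1)})"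
    using assms(1,2) by (intro bdd_aboveI2[where M = 1] disk_pseudohyperbolic_le_1) auto
qed (use assms in auto)

lemma pseudohyperbolic_leI:
  fixes x y :: "'b::complex_banach"
  assumes "\<And>f. f frechet_holomorphic_on ball 0 1 \<Longrightarrow> (\<And>w. w \<in> ball 0 1 \<Longrightarrow> cmod (f w) \<le> 1) \<Longrightarrow>
    disk_pseudohyperbolic (f x) (f y) \<le> r"
  shows "pseudohyperbolic x y \<le> r"
  unfolding pseudohyperbolic_def
proof (rule cSUP_least)
  have "(\<lambda>_. 0) \<in> {f::'b \<Rightarrow> complex. f frechet_holomorphic_on ball 0 1 \<and> (\<forall>w\<in>ball 0 1. cmod (f w) \<le> 1)}"
    by (auto simp: frechet_holomorphic_on_def intro!: exI[of _ "\<lambda>_. 0"])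
  then show "{f::'b \<Rightarrow> complex. f frechet_holomorphic_on ball 0 1 \<and> (\<forall>w\<in>ball 0 1. cmod (f w) \<le> 1)} \<noteq> {}"
    by blast
qed (use assms in blast)

text \<open>Holomorphic disks contract the pseudohyperbolic distances: along \<open>g\<close> every competing
  function restricts to a function on the unit disk, to which the Schwarz-Pick lemma applies.
  Thus a disk through two points bounds their distance from above.\<close>

lemma pseudohyperbolic_le_by_analytic_disk:
  fixes g :: "complex \<Rightarrow> 'b::complex_banach"
  assumes ball: "\<And>\<zeta>. cmod \<zeta> < 1 \<Longrightarrow> g \<zeta> \<in> ball 0 1"
    and deriv: "\<And>\<zeta>. cmod \<zeta> < 1 \<Longrightarrow> \<exists>v. (g has_derivative (\<lambda>c. c *\<^sub>C v)) (at \<zeta>)"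
    and r: "cmod r < 1"
  shows "pseudohyperbolic (g 0) (g r) \<le> cmod r"
proof (rule pseudohyperbolic_leI)
  fix f :: "'b \<Rightarrow> complex"
  assume f: "f frechet_holomorphic_on ball 0 1" "\<And>w. w \<in> ball 0 1 \<Longrightarrow> cmod (f w) \<le> 1"
  have "(f \<circ> g) field_differentiable (at \<zeta>)" if "cmod \<zeta> < 1" for \<zeta>
    using frechet_holomorphic_comp_field_differentiable[OF f(1), of g \<zeta>] ball[OF that] deriv[OF that]
    by blast
  then have "(f \<circ> g) holomorphic_on ball 0 1"
    by (simp add: holomorphic_on_def field_differentiable_at_within)
  then show "disk_pseudohyperbolic (f (g 0)) (f (g r)) \<le> cmod r"
    using Schwarz_Pick_at_0[of "f \<circ> g" r] f(2) ball r by simp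
qed

section \<open>The upper bound in the space of continuous functions vanishing at infinity\<close>

text \<open>A continuous function dominated by two elements of \<open>C\<^sub>0(S)\<close> vanishes at infinity. This shows
  that the pointwise formulas for the disk and for its derivative define elements of
  \<open>C\<^sub>0(S)\<close>.\<close>

lemma apply_c0_Abs_c0_dominated:
  assumes "continuous_on UNIV f" and C: "C > 0"
    and le: "\<And>t. cmod (f t) \<le> C * (cmod (apply_c0 u t) + cmod (apply_c0 v t))"
  shows "apply_c0 (Abs_c0 f) = f"
proof (rule Abs_c0_inverse, safe)
  fix \<epsilon> :: real assume "\<epsilon> > 0"
  then have e: "\<epsilon> / (2 * C) > 0" using C by simp
  obtain K where K: "closed K" "compact K" "\<forall>t\<in>- K. cmod (apply_c0 u t) < \<epsilon> / (2 * C)"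
    using apply_c0_vanishes[OF e] by blast
  obtain L where L: "closed L" "compact L" "\<forall>t\<in>- L. cmod (apply_c0 v t) < \<epsilon> / (2 * C)"
    using apply_c0_vanishes[OF e] by blast
  have "cmod (f t) < \<epsilon>" if "t \<in> - (K \<union> L)" for t
  proof -
    have "cmod (apply_c0 u t) + cmod (apply_c0 v t) < \<epsilon> / (2 * C) + \<epsilon> / (2 * C)"
      using K(3) L(3) that by (intro add_strict_mono) auto
    also have "\<dots> = \<epsilon> / C" by simp
    finally have "C * (cmod (apply_c0 u t) + cmod (apply_c0 v t)) < \<epsilon>"
      using C by (simp add: field_simps)
    then show ?thesis using le[of t] by linarith
  qed
  then show "\<exists>K. closed K \<and> compact K \<and> (\<forall>t\<in>- K. cmod (f t) < \<epsilon>)"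
    using K L by (intro exI[of _ "K \<union> L"]) auto
qed (rule assms)

text \<open>Pointwise derivatives give a derivative for the sup-norm once the remainder is quadratic with
  a constant independent of the point.\<close>

lemma has_derivative_c0I:
  fixes g :: "complex \<Rightarrow> 's::topological_space c0"
  assumes d: "d > 0" and B: "B \<ge> 0"
    and bound: "\<And>\<mu> t. cmod (\<mu> - \<zeta>) < d \<Longrightarrow>
      cmod (apply_c0 (g \<mu>) t - apply_c0 (g \<zeta>) t - (\<mu> - \<zeta>) * apply_c0 v t) \<le> B * (cmod (\<mu> - \<zeta>))\<^sup>2"
  shows "(g has_derivative (\<lambda>c. c *\<^sub>C v)) (at \<zeta>)"
  unfolding has_derivative_at_alt
proof (intro conjI allI impI bounded_linear_scaleC_left)
  fix e :: real assume e: "e > 0"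
  have "norm (g \<mu> - g \<zeta> - (\<mu> - \<zeta>) *\<^sub>C v) \<le> e * cmod (\<mu> - \<zeta>)"
    if \<mu>: "cmod (\<mu> - \<zeta>) < min d (e / (B + 1))" for \<mu>
  proof (rule norm_c0_leI)
    fix t
    have "B * cmod (\<mu> - \<zeta>) \<le> (B + 1) * cmod (\<mu> - \<zeta>)"
      by (simp add: mult_right_mono)
    also have "\<dots> \<le> e"
      using \<mu> B by (simp add: field_simps)
    finally have "B * cmod (\<mu> - \<zeta>) * cmod (\<mu> - \<zeta>) \<le> e * cmod (\<mu> - \<zeta>)"
      by (rule mult_right_mono) simp
    then show "cmod (apply_c0 (g \<mu> - g \<zeta> - (\<mu> - \<zeta>) *\<^sub>C v) t) \<le> e * cmod (\<mu> - \<zeta>)"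
      using bound[of \<mu> t] \<mu> by (simp add: apply_c0_diff scaleC_c0.rep_eq power2_eq_square mult.assoc)
  qed
  then show "\<exists>d>0. \<forall>\<mu>. cmod (\<mu> - \<zeta>) < d \<longrightarrow> norm (g \<mu> - g \<zeta> - (\<mu> - \<zeta>) *\<^sub>C v) \<le> e * cmod (\<mu> - \<zeta>)"
    using d e B by (intro exI[of _ "min d (e / (B + 1))"]) simp
qed

text \<open>For \<open>r \<ge> 1\<close> the bound is trivial. For \<open>r < 1\<close> the disk \<open>G\<close> below takes the values \<open>u\<close> and
  \<open>v\<close> at 0 and at \<open>r\<close>; dividing by \<open>r\<close> in the definition of \<open>w\<close> is what makes it defined on the
  whole unit disk. All estimates are uniform in \<open>t\<close> because \<open>a = \<parallel>u\<parallel> < 1\<close> keeps the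
  denominators \<open>1 + \<zeta> q(t)\<close> at distance at least \<open>1 - a\<close> from 0.\<close>

lemma pseudohyperbolic_c0_le:
  fixes u v :: "'s::topological_space c0"
  assumes u: "u \<in> ball 0 1" and v: "v \<in> ball 0 1" and r: "r > 0"
    and le: "\<And>t. disk_pseudohyperbolic (apply_c0 u t) (apply_c0 v t) \<le> r"
  shows "pseudohyperbolic u v \<le> r"
proof (cases "r < 1")
  case False
  show ?thesis
  proof (rule pseudohyperbolic_leI)
    fix f :: "'s c0 \<Rightarrow> complex"
    assume f: "\<And>w. w \<in> ball 0 1 \<Longrightarrow> cmod (f w) \<le> 1"
    have "disk_pseudohyperbolic (f u) (f v) \<le> 1"
      by (intro disk_pseudohyperbolic_le_1 f u v)
    then show "disk_pseudohyperbolic (f u) (f v) \<le> r"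
      using False by simp
  qed
next
  case True
  define a where "a = norm u"
  have a: "0 \<le> a" "a < 1" using u by (auto simp: a_def)
  define U where "U = apply_c0 u"
  define V where "V = apply_c0 v"
  have U: "cmod (U t) \<le> a" for t
    unfolding U_def a_def by (rule norm_apply_c0_le)
  have V: "cmod (V t) \<le> 1" for t
    using norm_apply_c0_le[of v t] v by (simp add: V_def)
  have contU: "continuous_on UNIV U" and contV: "continuous_on UNIV V"
    unfolding U_def V_def by (rule continuous_on_apply_c0)+
  define w where "w t = (V t - U t) / (1 - cnj (U t) * V t) / r" for t
  define q where "q t = cnj (U t) * w t" for t
  have den: "1 - a \<le> cmod (1 - cnj (U t) * V t)" for t
  proof -
    have "cmod (- (cnj (U t) * V t)) \<le> a"
      using mult_mono[OF U[of t] V[of t]] a by (simp add: norm_mult)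
    from cmod_one_plus_ge[OF this] show ?thesis by simp
  qed
  have den0: "1 - cnj (U t) * V t \<noteq> 0" for t
    using den[of t] a by auto
  have w1: "cmod (w t) \<le> 1" for t
  proof -
    have "cmod (w t) = disk_pseudohyperbolic (U t) (V t) / r"
      using r by (simp add: w_def disk_pseudohyperbolic_def norm_divide norm_mult norm_minus_commute)
    then show ?thesis
      using le[of t] r by (simp add: U_def V_def)
  qed
  have w_le: "cmod (w t) \<le> 1 / (r * (1 - a)) * (cmod (U t) + cmod (V t))" for t
  proof -
    have "cmod (V t - U t) / cmod (1 - cnj (U t) * V t) \<le> (cmod (U t) + cmod (V t)) / (1 - a)"
      using norm_triangle_ineq4[of "V t" "U t"] den[of t] a by (intro frac_le) auto
    from divide_right_mono[OF this, of r] show ?thesis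
      using r by (simp add: w_def norm_divide norm_mult mult.commute)
  qed
  have qle: "cmod (\<zeta> * q t) \<le> a" if "cmod \<zeta> < 1" for \<zeta> t
  proof -
    have "cmod (\<zeta> * q t) \<le> 1 * (a * 1)"
      unfolding q_def norm_mult using that U w1 a by (intro mult_mono) auto
    then show ?thesis by simp
  qed
  have q: "1 - a \<le> cmod (1 + \<zeta> * q t)" if "cmod \<zeta> < 1" for \<zeta> t
    by (rule cmod_one_plus_ge[OF qle[OF that]])
  have q0: "1 + \<zeta> * q t \<noteq> 0" if "cmod \<zeta> < 1" for \<zeta> t
    using q[OF that, of t] a by auto
  have contw: "continuous_on UNIV w"
    unfolding w_def using den0 r by (intro continuous_intros contU contV) auto
  have contq: "continuous_on UNIV q"
    unfolding q_def by (intro continuous_intros contU contw)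
  define G where "G \<zeta> t = (U t + \<zeta> * w t) / (1 + \<zeta> * q t)" for \<zeta> t
  define G' where "G' \<zeta> t = w t * (1 - cnj (U t) * U t) / (1 + \<zeta> * q t)\<^sup>2" for \<zeta> t
  define C where "C = 1 / (r * (1 - a))"
  have C0: "C > 0" using r a by (simp add: C_def)
  have appG: "apply_c0 (Abs_c0 (G \<zeta>)) = G \<zeta>" if \<zeta>: "cmod \<zeta> < 1" for \<zeta>
  proof (rule apply_c0_Abs_c0_dominated[where u = u and v = v and C = "(1 + C) / (1 - a)"])
    show "continuous_on UNIV (G \<zeta>)"
      unfolding G_def using q0[OF \<zeta>] by (intro continuous_intros contU contw contq) auto
    show "(1 + C) / (1 - a) > 0" using C0 a by simp
    fix t
    have "cmod (\<zeta> * w t) \<le> 1 * cmod (w t)"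
      unfolding norm_mult using \<zeta> by (intro mult_right_mono) auto
    then have "cmod (U t + \<zeta> * w t) \<le> cmod (U t) + C * (cmod (U t) + cmod (V t))"
      using norm_triangle_ineq[of "U t" "\<zeta> * w t"] w_le[of t] unfolding C_def by linarith
    also have "\<dots> \<le> (1 + C) * (cmod (U t) + cmod (V t))"
      by (simp add: algebra_simps)
    finally have "cmod (G \<zeta> t) \<le> (1 + C) * (cmod (U t) + cmod (V t)) / (1 - a)"
      unfolding G_def norm_divide using q[OF \<zeta>, of t] a C0 by (intro frac_le) auto
    then show "cmod (G \<zeta> t) \<le> (1 + C) / (1 - a) * (cmod (apply_c0 u t) + cmod (apply_c0 v t))"
      by (simp add: U_def V_def)
  qed
  have UU: "cmod (1 - cnj (U t) * U t) \<le> 1" for t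
  proof -
    have "1 - cnj (U t) * U t = of_real (1 - (cmod (U t))\<^sup>2)"
      using complex_norm_square[of "U t"] by (simp add: mult.commute)
    then have "cmod (1 - cnj (U t) * U t) = \<bar>1 - (cmod (U t))\<^sup>2\<bar>"
      by (simp only: norm_of_real)
    moreover have "(cmod (U t))\<^sup>2 \<le> 1"
      using U[of t] a by (intro power_le_one) auto
    ultimately show ?thesis by simp
  qed
  have appG': "apply_c0 (Abs_c0 (G' \<zeta>)) = G' \<zeta>" if \<zeta>: "cmod \<zeta> < 1" for \<zeta>
  proof (rule apply_c0_Abs_c0_dominated[where u = u and v = v and C = "C / (1 - a)\<^sup>2"])
    show "continuous_on UNIV (G' \<zeta>)"
      unfolding G'_def using q0[OF \<zeta>] by (intro continuous_intros contU contw contq) auto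
    show "C / (1 - a)\<^sup>2 > 0" using C0 a by simp
    fix t
    have "cmod (w t * (1 - cnj (U t) * U t)) \<le> cmod (w t) * 1"
      unfolding norm_mult by (intro mult_left_mono UU) simp
    also have "\<dots> \<le> C * (cmod (U t) + cmod (V t))"
      using w_le[of t] by (simp add: C_def)
    finally have "cmod (G' \<zeta> t) \<le> C * (cmod (U t) + cmod (V t)) / (1 - a)\<^sup>2"
      unfolding G'_def norm_divide norm_power using q[OF \<zeta>, of t] a C0
      by (intro frac_le power_mono) auto
    then show "cmod (G' \<zeta> t) \<le> C / (1 - a)\<^sup>2 * (cmod (apply_c0 u t) + cmod (apply_c0 v t))"
      by (simp add: U_def V_def)
  qed
  have "pseudohyperbolic (Abs_c0 (G 0)) (Abs_c0 (G (of_real r))) \<le> cmod (of_real r)"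
  proof (rule pseudohyperbolic_le_by_analytic_disk)
    fix \<zeta> :: complex assume \<zeta>: "cmod \<zeta> < 1"
    \<comment> \<open>The pointwise bound \<open>|G \<zeta> t| < 1\<close> would give only norm at most 1; \<open>\<delta>\<close> is a gap in the
      squared modulus that does not depend on \<open>t\<close>.\<close>
    define \<delta> where "\<delta> = (1 - a\<^sup>2) * (1 - (cmod \<zeta>)\<^sup>2) / 4"
    have \<delta>: "\<delta> > 0"
      using a \<zeta> by (simp add: \<delta>_def power_less_one_iff abs_square_less_1)
    have "cmod (G \<zeta> t) \<le> sqrt (1 - \<delta>)" for t
    proof (rule real_le_rsqrt)
      have wz: "cmod (\<zeta> * w t) \<le> cmod \<zeta>"
        using mult_left_mono[OF w1[of t], of "cmod \<zeta>"] by (simp add: norm_mult)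
      have "(cmod (1 + \<zeta> * q t))\<^sup>2 - (cmod (U t + \<zeta> * w t))\<^sup>2
          = (1 - (cmod (U t))\<^sup>2) * (1 - (cmod (\<zeta> * w t))\<^sup>2)"
        using cmod_one_minus_cnj_mult[of "U t" "- (\<zeta> * w t)"] by (simp add: q_def mult_ac)
      also have "\<dots> \<ge> (1 - a\<^sup>2) * (1 - (cmod \<zeta>)\<^sup>2)"
        using U[of t] wz a \<zeta>
        by (intro mult_mono diff_left_mono power_mono) (auto intro: power_le_one)
      finally have 1: "(cmod (U t + \<zeta> * w t))\<^sup>2 \<le> (cmod (1 + \<zeta> * q t))\<^sup>2 - 4 * \<delta>"
        by (simp add: \<delta>_def)
      have "cmod (1 + \<zeta> * q t) \<le> 2"
        using norm_triangle_ineq[of 1 "\<zeta> * q t"] qle[OF \<zeta>, of t] a by simp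
      then have "(cmod (1 + \<zeta> * q t))\<^sup>2 \<le> 4"
        using power_mono[of "cmod (1 + \<zeta> * q t)" 2 2] by simp
      then have "\<delta> * (cmod (1 + \<zeta> * q t))\<^sup>2 \<le> \<delta> * 4"
        using \<delta> by (intro mult_left_mono) auto
      with 1 have "(cmod (U t + \<zeta> * w t))\<^sup>2 \<le> (1 - \<delta>) * (cmod (1 + \<zeta> * q t))\<^sup>2"
        by (simp add: algebra_simps)
      then show "(cmod (G \<zeta> t))\<^sup>2 \<le> 1 - \<delta>"
        using q0[OF \<zeta>, of t] by (simp add: G_def norm_divide power_divide divide_le_eq)
    qed
    then have "norm (Abs_c0 (G \<zeta>)) \<le> sqrt (1 - \<delta>)"
      by (intro norm_c0_leI) (simp add: appG[OF \<zeta>])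
    also have "\<dots> < 1" using \<delta> by simp
    finally show "Abs_c0 (G \<zeta>) \<in> ball 0 1" by simp
    have "((\<lambda>\<zeta>. Abs_c0 (G \<zeta>)) has_derivative (\<lambda>c. c *\<^sub>C Abs_c0 (G' \<zeta>))) (at \<zeta>)"
    proof (rule has_derivative_c0I[where d = "1 - cmod \<zeta>" and B = "1 / (1 - a) ^ 3"])
      fix \<mu> t assume "cmod (\<mu> - \<zeta>) < 1 - cmod \<zeta>"
      then have \<mu>: "cmod \<mu> < 1"
        using norm_triangle_sub[of \<mu> \<zeta>] by linarith
      define k where "k = 1 - cnj (U t) * U t"
      define A where "A = 1 + \<zeta> * q t"
      define B where "B = 1 + \<mu> * q t"
      have nz: "A \<noteq> 0" "B \<noteq> 0"
        unfolding A_def B_def using q0 \<zeta> \<mu> by auto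
      have "(U t + \<mu> * w t) * A - (U t + \<zeta> * w t) * B = (\<mu> - \<zeta>) * w t * k"
        by (simp add: A_def B_def q_def k_def algebra_simps)
      then have "G \<mu> t - G \<zeta> t = (\<mu> - \<zeta>) * w t * k / (A * B)"
        unfolding G_def A_def[symmetric] B_def[symmetric] using nz
        by (simp add: diff_frac_eq mult.commute)
      moreover have "(\<mu> - \<zeta>) * w t * k / (A * B) - (\<mu> - \<zeta>) * (w t * k / A\<^sup>2)
          = (\<mu> - \<zeta>) * w t * k * (A - B) / (A\<^sup>2 * B)"
        using nz by (simp add: field_simps power2_eq_square)
      moreover have "A - B = - ((\<mu> - \<zeta>) * q t)"
        by (simp add: A_def B_def algebra_simps)
      ultimately have eq: "G \<mu> t - G \<zeta> t - (\<mu> - \<zeta>) * G' \<zeta> t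
          = - ((\<mu> - \<zeta>)\<^sup>2 * (w t * k * q t)) / (A\<^sup>2 * B)"
        unfolding G'_def A_def[symmetric] k_def[symmetric] by (simp add: power2_eq_square)
      have "cmod (q t) \<le> 1 * 1"
        unfolding q_def norm_mult using U[of t] w1[of t] a by (intro mult_mono) auto
      then have "cmod (w t * k * q t) \<le> 1 * 1 * 1"
        unfolding norm_mult k_def using w1 UU by (intro mult_mono) auto
      then have num: "cmod (- ((\<mu> - \<zeta>)\<^sup>2 * (w t * k * q t))) \<le> (cmod (\<mu> - \<zeta>))\<^sup>2"
        using mult_left_mono[of "cmod (w t * k * q t)" 1 "(cmod (\<mu> - \<zeta>))\<^sup>2"]
        by (simp add: norm_mult norm_power)
      have "(1 - a)\<^sup>2 * (1 - a) \<le> (cmod A)\<^sup>2 * cmod B"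
        unfolding A_def B_def using q \<zeta> \<mu> a by (intro mult_mono power_mono) auto
      then have "(1 - a) ^ 3 \<le> cmod (A\<^sup>2 * B)"
        by (simp add: norm_mult norm_power power2_eq_square power3_eq_cube)
      then have "cmod (G \<mu> t - G \<zeta> t - (\<mu> - \<zeta>) * G' \<zeta> t) \<le> (cmod (\<mu> - \<zeta>))\<^sup>2 / (1 - a) ^ 3"
        unfolding eq norm_divide using a by (intro frac_le num) auto
      then show "cmod (apply_c0 (Abs_c0 (G \<mu>)) t - apply_c0 (Abs_c0 (G \<zeta>)) t
          - (\<mu> - \<zeta>) * apply_c0 (Abs_c0 (G' \<zeta>)) t) \<le> 1 / (1 - a) ^ 3 * (cmod (\<mu> - \<zeta>))\<^sup>2"
        by (simp add: appG[OF \<mu>] appG[OF \<zeta>] appG'[OF \<zeta>])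
    qed (use a \<zeta> in auto)
    then show "\<exists>v. ((\<lambda>\<zeta>. Abs_c0 (G \<zeta>)) has_derivative (\<lambda>c. c *\<^sub>C v)) (at \<zeta>)" ..
  qed (use r True in simp)
  moreover have "G 0 = U"
    by (simp add: G_def fun_eq_iff)
  moreover have "G (of_real r) = V"
  proof
    fix t
    define D where "D = 1 - cnj (U t) * V t"
    have D: "D \<noteq> 0" using den0 by (simp add: D_def)
    have rw: "of_real r * w t = (V t - U t) / D"
      using r by (simp add: w_def D_def)
    have "G (of_real r) t = (U t + (V t - U t) / D) / (1 + cnj (U t) * ((V t - U t) / D))"
      by (simp add: G_def q_def mult.left_commute flip: rw)
    also have "U t + (V t - U t) / D = V t * (1 - cnj (U t) * U t) / D"
      using D by (simp add: field_simps) (simp add: D_def algebra_simps)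
    also have "1 + cnj (U t) * ((V t - U t) / D) = (1 - cnj (U t) * U t) / D"
      using D by (simp add: field_simps) (simp add: D_def algebra_simps)
    also have "V t * (1 - cnj (U t) * U t) / D / ((1 - cnj (U t) * U t) / D) = V t"
    proof -
      have "(cmod (U t))\<^sup>2 < 1"
        using U[of t] a by (simp add: abs_square_less_1)
      then have "cnj (U t) * U t \<noteq> 1"
        by (metis complex_norm_square mult.commute of_real_eq_1_iff order_less_irrefl)
      then show ?thesis using D by simp
    qed
    finally show "G (of_real r) t = V t" .
  qed
  ultimately show ?thesis
    using r by (simp add: U_def V_def apply_c0_inverse)
qed

text \<open>Evaluation at \<open>t\<close> is linear and of norm at most 1, hence a competing function.\<close>

lemma disk_pseudohyperbolic_apply_c0_le:
  fixes x y :: "'s::topological_space c0"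
  assumes "x \<in> ball 0 1" and "y \<in> ball 0 1"
  shows "disk_pseudohyperbolic (apply_c0 x t) (apply_c0 y t) \<le> pseudohyperbolic x y"
proof (rule disk_pseudohyperbolic_le_pseudohyperbolic[OF assms, where f = "\<lambda>f. apply_c0 f t"])
  have "bounded_linear (\<lambda>f :: 's c0. apply_c0 f t)"
    by (rule bounded_linear_intro[where K = 1])
      (simp_all add: plus_c0.rep_eq scaleR_c0.rep_eq norm_apply_c0_le scaleR_conv_of_real)
  then show "(\<lambda>f. apply_c0 f t) frechet_holomorphic_on ball 0 1"
    unfolding frechet_holomorphic_on_def
    by (auto intro!: exI[of _ "\<lambda>f. apply_c0 f t"] bounded_linear_imp_has_derivative simp: scaleC_c0.rep_eq)
  show "cmod (apply_c0 w t) \<le> 1" if "w \<in> ball 0 1" for w :: "'s c0"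
    using norm_apply_c0_le[of w t] that by simp
qed

theorem proposition2p8:
  fixes x y :: "('s::topological_space) c0" and z :: complex
  assumes "locally_compact_space (euclidean :: 's topology)"
    and "x \<in> ball 0 1" and "y \<in> ball 0 1" and "x \<noteq> y"
    and "z \<noteq> 0"
    and "cmod z \<le> (1 + max (norm x) (norm y)) / (2 * max (norm x) (norm y))"
  shows "pseudohyperbolic (z *\<^sub>C x) (z *\<^sub>C y) / (cmod z * pseudohyperbolic x y) \<le> 2"
proof -
  define M where "M = max (norm x) (norm y)"
  have M: "0 < M" "M < 1"
    using assms(2-4) by (auto simp: M_def less_max_iff_disj)
  have x: "norm x \<le> M" and y: "norm y \<le> M" by (simp_all add: M_def)
  have z: "cmod z \<le> (1 + M) / (2 * M)" using assms(6) by (simp add: M_def)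
  have "cmod z * M \<le> (1 + M) / 2" using z M by (simp add: field_simps)
  also have "\<dots> < 1" using M by simp
  finally have "cmod z * M < 1" .
  then have ball: "z *\<^sub>C x \<in> ball 0 1" "z *\<^sub>C y \<in> ball 0 1"
    using mult_left_mono[OF x, of "cmod z"] mult_left_mono[OF y, of "cmod z"]
    by (simp_all add: norm_scaleC)
  have nonneg: "pseudohyperbolic x y \<ge> 0"
    using disk_pseudohyperbolic_apply_c0_le[OF assms(2,3)] disk_pseudohyperbolic_nonneg
    by (meson order_trans)
  show ?thesis
  proof (cases "pseudohyperbolic x y = 0")
    \<comment> \<open>The quotient by 0 is 0.\<close>
    case True
    then show ?thesis by simp
  next
    case False
    with nonneg \<open>z \<noteq> 0\<close> have pos: "cmod z * pseudohyperbolic x y > 0" by simp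
    have "pseudohyperbolic (z *\<^sub>C x) (z *\<^sub>C y) \<le> 2 * (cmod z * pseudohyperbolic x y)"
    proof (rule pseudohyperbolic_c0_le[OF ball])
      fix t
      have "disk_pseudohyperbolic (z * apply_c0 x t) (z * apply_c0 y t)
          \<le> 2 * cmod z * disk_pseudohyperbolic (apply_c0 x t) (apply_c0 y t)"
        using norm_apply_c0_le[of x t] norm_apply_c0_le[of y t] x y M z
        by (intro disk_pseudohyperbolic_scale_le[where M = M]) auto
      also have "\<dots> \<le> 2 * cmod z * pseudohyperbolic x y"
        by (intro mult_left_mono disk_pseudohyperbolic_apply_c0_le assms(2,3)) simp
      finally show "disk_pseudohyperbolic (apply_c0 (z *\<^sub>C x) t) (apply_c0 (z *\<^sub>C y) t)
          \<le> 2 * (cmod z * pseudohyperbolic x y)"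
        by (simp add: scaleC_c0.rep_eq mult.assoc)
    qed (use pos in simp)
    then show ?thesis
      using pos by (simp add: divide_le_eq)
  qed
qed

end
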